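(* Suppose that $A,B,Z\in \mathbb{C}^{n\times n}$ are all Hermitian positive semi-definite. Let $\alpha>0$, $\beta>0$ and $$F_{\alpha,\beta}=(A+\alpha Z):(B+\beta Z)-A:B.$$ Then $$\Vert F_{\alpha,\beta}\Vert\le \frac{1}{\alpha+\beta}\left[\frac{\Vert (A+B)^\dagger (\beta A-\alpha B)\Vert^2\cdot \Vert A+B\Vert}{\Vert A+B\Vert+(\alpha+\beta)\Vert Z\Vert}+\alpha\beta\right]\Vert Z\Vert$$ $$\le \frac{1}{\alpha+\beta}\Big[\Vert (A+B)^\dagger (\beta A-\alpha B)\Vert^2+\alpha\beta\Big]\Vert Z\Vert.$$
   Context: $\mathbb{C}^{n\times n}$ is the set of all $n\times n$ complex matrices; $M^*$ is the conjugate transpose of $M$ and $\Vert M\Vert$ is the 2-norm (spectral/operator norm) of $M$. $M^\dagger$ denotes the Moore-Penrose inverse of $M$, i.e. the unique matrix satisfying $MM^\dagger M=M$, $M^\dagger MM^\dagger=M^\dagger$, $(MM^\dagger)^*=MM^\dagger$, $(M^\dagger M)^*=M^\dagger M$. The parallel sum of Hermitian positive semi-definite matrices $P,Q\in\mathbb{C}^{n\times n}$ is $P:Q=P(P+Q)^\dagger Q$. *)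

theory Defs
  imports "HOL-Analysis.Analysis"
begin

definition conjugate_transpose :: "complex ^ 'n ^ 'm \<Rightarrow> complex ^ 'm ^ 'n" where
  "conjugate_transpose M = (\<chi> i j. cnj (M $ j $ i))"

definition hermitian :: "complex ^ 'n ^ 'n \<Rightarrow> bool" where
  "hermitian M \<longleftrightarrow> conjugate_transpose M = M"

definition positive_semidefinite :: "complex ^ 'n ^ 'n \<Rightarrow> bool" where
  "positive_semidefinite M \<longleftrightarrow>
     (\<forall>x. (\<Sum>i\<in>UNIV. cnj (x $ i) * (M *v x) $ i) \<in> \<real>\<^sub>\<ge>\<^sub>0)"

text \<open>The library instance \<open>norm\<close> on \<open>complex ^ 'n ^ 'm\<close> is the Frobenius norm. The spectral
  norm is instead the operator norm with respect to the Euclidean norm on \<open>complex ^ 'n\<close>.\<close>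

definition spectral_norm :: "complex ^ 'n ^ 'm \<Rightarrow> real" where
  "spectral_norm M = onorm (\<lambda>x. M *v x)"

definition is_moore_penrose_inverse :: "complex ^ 'n ^ 'm \<Rightarrow> complex ^ 'm ^ 'n \<Rightarrow> bool" where
  "is_moore_penrose_inverse M X \<longleftrightarrow>
     M ** X ** M = M \<and> X ** M ** X = X \<and> hermitian (M ** X) \<and> hermitian (X ** M)"

definition moore_penrose_inverse :: "complex ^ 'n ^ 'm \<Rightarrow> complex ^ 'm ^ 'n" where
  "moore_penrose_inverse M = (THE X. is_moore_penrose_inverse M X)"

definition parallel_sum :: "complex ^ 'n ^ 'n \<Rightarrow> complex ^ 'n ^ 'n \<Rightarrow> complex ^ 'n ^ 'n" where
  "parallel_sum P Q = P ** moore_penrose_inverse (P + Q) ** Q"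

end

(* With W = \<beta>A - \<alpha>B one has (\<alpha> + \<beta>)^2 (A : B) = \<beta>^2 A + \<alpha>^2 B - W (A + B)^+ W, where ^+ is the
   Moore-Penrose inverse, and W is unchanged when (A, B) is replaced by (A + \<alpha>Z, B + \<beta>Z). With
   S = A + B, R = (\<alpha> + \<beta>)Z and X = S^+ W, subtracting the two instances gives
   (\<alpha> + \<beta>)^2 F = \<alpha>\<beta>(\<alpha> + \<beta>) Z + X* (S - S (S + R)^+ S) X. The matrix in the middle is the parallel
   sum S : R, whose quadratic form is at most (1 - t)^2 <Sx, x> + t^2 <Rx, x> for every real t;
   t = |S| / (|S| + |R|) gives |S : R| <= |S||R| / (|S| + |R|). *)

theory Submission
  imports Defs
begin

section \<open>Adjoints, Hermitian matrices and quadratic forms\<close>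

lemma scaleR_matrix_vector_mult:
  fixes A :: "'a :: real_algebra_1 ^ 'n ^ 'm"
  shows "(r *\<^sub>R A) *v x = r *\<^sub>R (A *v x)"
  by (simp add: matrix_vector_mult_def vec_eq_iff scaleR_sum_right)

lemma matrix_vector_mult_scaleR_gen:
  fixes A :: "'a :: real_algebra_1 ^ 'n ^ 'm"
  shows "A *v (r *\<^sub>R x) = r *\<^sub>R (A *v x)"
  by (simp add: matrix_vector_mult_def vec_eq_iff scaleR_sum_right)

lemma conjugate_transpose_mult:
  "conjugate_transpose (M ** N) = conjugate_transpose N ** conjugate_transpose M"
  by (simp add: conjugate_transpose_def matrix_matrix_mult_def vec_eq_iff mult.commute)

lemma conjugate_transpose_diff:
  "conjugate_transpose (M - N) = conjugate_transpose M - conjugate_transpose N"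
  by (simp add: conjugate_transpose_def vec_eq_iff)

lemma conjugate_transpose_scaleR:
  "conjugate_transpose (r *\<^sub>R M) = r *\<^sub>R conjugate_transpose M"
  by (simp add: conjugate_transpose_def vec_eq_iff)

lemma hermitian_add: "hermitian M \<Longrightarrow> hermitian N \<Longrightarrow> hermitian (M + N)"
  by (simp add: hermitian_def conjugate_transpose_def vec_eq_iff)

lemma hermitian_diff: "hermitian M \<Longrightarrow> hermitian N \<Longrightarrow> hermitian (M - N)"
  by (simp add: hermitian_def conjugate_transpose_diff)

lemma hermitian_scaleR: "hermitian M \<Longrightarrow> hermitian (r *\<^sub>R M)"
  by (simp add: hermitian_def conjugate_transpose_scaleR)

text \<open>On complex vectors \<open>\<bullet>\<close> is the real part of the Hermitian product,
  and adjointness survives taking real parts, entry by entry. All later arguments with quadratic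
  forms can therefore use this real inner product.\<close>

lemma inner_conjugate_transpose:
  "(M *v x) \<bullet> y = x \<bullet> (conjugate_transpose M *v y)"
proof -
  have "(M *v x) \<bullet> y = (\<Sum>i\<in>UNIV. \<Sum>j\<in>UNIV. (M $ i $ j * x $ j) \<bullet> y $ i)"
    by (simp add: inner_vec_def matrix_vector_mult_def inner_sum_left)
  also have "\<dots> = (\<Sum>i\<in>UNIV. \<Sum>j\<in>UNIV. x $ j \<bullet> (cnj (M $ i $ j) * y $ i))"
    by (intro sum.cong refl) (simp add: inner_complex_def algebra_simps)
  also have "\<dots> = (\<Sum>j\<in>UNIV. \<Sum>i\<in>UNIV. x $ j \<bullet> (cnj (M $ i $ j) * y $ i))"
    by (rule sum.swap)
  also have "\<dots> = x \<bullet> (conjugate_transpose M *v y)"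
    by (simp add: inner_vec_def matrix_vector_mult_def inner_sum_right conjugate_transpose_def)
  finally show ?thesis .
qed

lemma hermitian_inner: "hermitian M \<Longrightarrow> (M *v x) \<bullet> y = x \<bullet> (M *v y)"
  by (simp add: inner_conjugate_transpose hermitian_def)

lemma positive_semidefinite_inner:
  assumes "positive_semidefinite M"
  shows "0 \<le> x \<bullet> (M *v x)"
proof -
  have "x \<bullet> (M *v x) = Re (\<Sum>i\<in>UNIV. cnj (x $ i) * (M *v x) $ i)"
    by (simp add: inner_vec_def inner_complex_def)
  then show ?thesis
    using assms by (auto simp: positive_semidefinite_def complex_nonneg_Reals_iff)
qed

text \<open>One closure property for three uses: shifts such as A + \<alpha>Z, plain sums
  (\<open>r = 1\<close>) and nonnegative multiples (\<open>M = 0\<close>).\<close>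

lemma positive_semidefinite_add_scaleR:
  fixes M N :: "complex ^ 'n ^ 'n"
  assumes "positive_semidefinite M" "positive_semidefinite N" "0 \<le> r"
  shows "positive_semidefinite (M + r *\<^sub>R N)"
  unfolding positive_semidefinite_def
proof
  fix x :: "complex ^ 'n"
  let ?q = "\<lambda>K :: complex ^ 'n ^ 'n. \<Sum>i\<in>UNIV. cnj (x $ i) * (K *v x) $ i"
  have "?q (M + r *\<^sub>R N) = ?q M + of_real r * ?q N"
    unfolding matrix_vector_mult_add_rdistrib scaleR_matrix_vector_mult
    by (simp add: sum_distrib_left sum.distrib algebra_simps
        flip: scaleR_conv_of_real)
  then show "?q (M + r *\<^sub>R N) \<in> \<real>\<^sub>\<ge>\<^sub>0"
    using assms by (simp add: positive_semidefinite_def)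
qed

text \<open>Otherwise \<open>x\<close> could be perturbed along \<open>M *v x\<close> so as to make the form negative.\<close>

lemma inner_kernel:
  assumes h: "hermitian M" and p: "\<And>x. 0 \<le> x \<bullet> (M *v x)" and k: "x \<bullet> (M *v x) = 0"
  shows "M *v x = 0"
proof (rule ccontr)
  assume "M *v x \<noteq> 0"
  define y where "y = M *v x"
  define c where "c = y \<bullet> (M *v y)"
  have n: "0 < y \<bullet> y" using \<open>M *v x \<noteq> 0\<close> by (simp add: y_def)
  have q: "0 \<le> t\<^sup>2 * c - 2 * t * (y \<bullet> y)" for t
  proof -
    have "x \<bullet> (M *v y) = y \<bullet> y"
      using hermitian_inner[OF h, of x y] by (simp add: y_def)
    then show ?thesis
      using p[of "x - t *\<^sub>R y"] k
      by (simp add: c_def y_def[symmetric] inner_diff_left inner_diff_right inner_commute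
          matrix_vector_mult_diff_distrib matrix_vector_mult_scaleR_gen power2_eq_square algebra_simps)
  qed
  have "0 \<le> c" using p by (simp add: c_def)
  \<comment> \<open>The quadratic t^2 c - 2t|y|^2 is negative for small positive t. The value |y|^2
    / c would minimise it; the added 1 keeps the denominator positive when c = 0.\<close>
  define t where "t = (y \<bullet> y) / (c + 1)"
  have t: "0 < t" "t * (c + 1) = y \<bullet> y" using n \<open>0 \<le> c\<close> by (simp_all add: t_def)
  have "t * (t * c) < t * (2 * (y \<bullet> y))"
  proof (rule mult_strict_left_mono)
    show "t * c < 2 * (y \<bullet> y)" using t n unfolding distrib_left by linarith
  qed (rule t)
  then show False using q[of t] by (simp add: power2_eq_square algebra_simps)
qed

section \<open>The spectral norm\<close>

lemma spectral_norm_nonneg: "0 \<le> spectral_norm (M :: complex ^ 'n ^ 'm)"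
  by (simp add: spectral_norm_def onorm_pos_le)

lemma norm_matrix_vector_le_spectral_norm:
  "norm (M *v x) \<le> spectral_norm M * norm (x :: complex ^ 'n)"
  unfolding spectral_norm_def by (intro onorm) simp

lemma spectral_norm_le:
  fixes M :: "complex ^ 'n ^ 'm"
  assumes "\<And>x. norm (M *v x) \<le> b * norm x"
  shows "spectral_norm M \<le> b"
  unfolding spectral_norm_def by (intro onorm_le assms)

lemma inner_le_spectral_norm: "x \<bullet> (M *v x) \<le> spectral_norm M * (norm x)\<^sup>2"
proof -
  have "x \<bullet> (M *v x) \<le> norm x * norm (M *v x)" by (rule norm_cauchy_schwarz)
  also have "\<dots> \<le> norm x * (spectral_norm M * norm x)"
    by (intro mult_left_mono norm_matrix_vector_le_spectral_norm) simp
  finally show ?thesis by (simp add: power2_eq_square algebra_simps)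
qed

lemma spectral_norm_mult_le: "spectral_norm (M ** N) \<le> spectral_norm M * spectral_norm N"
proof (rule spectral_norm_le)
  fix x
  have "norm ((M ** N) *v x) \<le> spectral_norm M * norm (N *v x)"
    by (simp add: matrix_vector_mul_assoc[symmetric] norm_matrix_vector_le_spectral_norm)
  also have "\<dots> \<le> spectral_norm M * (spectral_norm N * norm x)"
    by (intro mult_left_mono norm_matrix_vector_le_spectral_norm spectral_norm_nonneg)
  finally show "norm ((M ** N) *v x) \<le> spectral_norm M * spectral_norm N * norm x"
    by (simp add: algebra_simps)
qed

lemma spectral_norm_add_le: "spectral_norm (M + N) \<le> spectral_norm M + spectral_norm N"
  unfolding spectral_norm_def matrix_vector_mult_add_rdistrib by (intro onorm_triangle) simp_all

lemma spectral_norm_scaleR: "spectral_norm (r *\<^sub>R M) = \<bar>r\<bar> * spectral_norm M"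
  by (simp add: spectral_norm_def scaleR_matrix_vector_mult onorm_scaleR)

text \<open>For y = M* x, |y|^2 = <My, x> <= |M| |y| |x|; a nonzero |y| is then cancelled.\<close>

lemma spectral_norm_conjugate_transpose_le:
  "spectral_norm (conjugate_transpose M) \<le> spectral_norm M"
proof (rule spectral_norm_le)
  fix x
  define y where "y = conjugate_transpose M *v x"
  have "norm y * norm y = (M *v y) \<bullet> x"
    by (simp add: inner_conjugate_transpose y_def flip: power2_eq_square power2_norm_eq_inner)
  also have "\<dots> \<le> norm (M *v y) * norm x" by (rule norm_cauchy_schwarz)
  also have "\<dots> \<le> spectral_norm M * norm y * norm x"
    by (intro mult_right_mono norm_matrix_vector_le_spectral_norm) simp
  finally have "norm y * norm y \<le> norm y * (spectral_norm M * norm x)"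
    by (simp add: algebra_simps)
  then have "norm y \<le> spectral_norm M * norm x"
    by (cases "norm y = 0")
      (use spectral_norm_nonneg[of M] in \<open>auto simp: mult_le_cancel_left zero_less_norm_iff\<close>)
  then show "norm (conjugate_transpose M *v x) \<le> spectral_norm M * norm x"
    by (simp add: y_def)
qed

text \<open>This passes from forms to norms without eigenvalues. With y = Mx, positivity at kx - y
  reads 0 <= k^2 <x, Mx> - 2k|y|^2 + <y, My>; bounding both forms by \<open>b\<close> leaves k|y|^2
  <= k^3 |x|^2.\<close>

lemma spectral_norm_le_of_form:
  assumes h: "hermitian M" and p: "\<And>x. 0 \<le> x \<bullet> (M *v x)"
    and b: "\<And>x. x \<bullet> (M *v x) \<le> k * (norm x)\<^sup>2" and k: "0 \<le> k"
  shows "spectral_norm M \<le> k"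
proof (rule spectral_norm_le)
  fix x
  define y where "y = M *v x"
  have xy: "x \<bullet> (M *v y) = y \<bullet> y" "y \<bullet> (M *v x) = y \<bullet> y"
    using hermitian_inner[OF h, of x y] by (simp_all add: y_def)
  have "0 \<le> (k *\<^sub>R x - y) \<bullet> (M *v (k *\<^sub>R x - y))" by (rule p)
  then have *: "0 \<le> k\<^sup>2 * (x \<bullet> (M *v x)) - 2 * k * (y \<bullet> y) + y \<bullet> (M *v y)"
    using xy by (simp add: inner_diff_left inner_diff_right matrix_vector_mult_diff_distrib
        matrix_vector_mult_scaleR_gen power2_eq_square algebra_simps)
  have "k\<^sup>2 * (x \<bullet> (M *v x)) \<le> k\<^sup>2 * (k * (norm x)\<^sup>2)"
    by (intro mult_left_mono b) simp
  moreover have "y \<bullet> (M *v y) \<le> k * (y \<bullet> y)"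
    using b[of y] by (simp add: power2_norm_eq_inner)
  ultimately have **: "k * (y \<bullet> y) \<le> k * (k\<^sup>2 * (norm x)\<^sup>2)"
    using * by (simp add: algebra_simps)
  have "(norm y)\<^sup>2 \<le> (k * norm x)\<^sup>2"
  \<comment> \<open>For k = 0 the factor k cannot be cancelled, but then the form vanishes
    identically and \<open>inner_kernel\<close> gives Mx = 0.\<close>
  proof (cases "k = 0")
    case True
    then have "M *v x = 0" by (intro inner_kernel[OF h p]) (use b[of x] p[of x] in simp)
    then show ?thesis by (simp add: y_def)
  next
    case False
    then show ?thesis using ** k
      by (simp add: mult_le_cancel_left power_mult_distrib power2_norm_eq_inner)
  qed
  then show "norm (M *v x) \<le> k * norm x"
    using k by (simp add: y_def power2_le_iff_abs_le)
qed

section \<open>The Moore-Penrose inverse of a Hermitian matrix\<close>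

text \<open>MX and MY are Hermitian with (MY)(MX) = MX and (MX)(MY) = MY, so taking adjoints
  identifies them; likewise XM = YM. Then X = XMX = YMY = Y.\<close>

lemma moore_penrose_inverse_unique:
  assumes X: "is_moore_penrose_inverse M X" and Y: "is_moore_penrose_inverse M Y"
  shows "X = Y"
proof -
  have MX: "M ** X = M ** Y"
  proof -
    have "M ** X = (M ** Y) ** (M ** X)"
      using Y by (simp add: is_moore_penrose_inverse_def matrix_mul_assoc)
    also have "\<dots> = conjugate_transpose ((M ** X) ** (M ** Y))"
      using X Y by (simp add: is_moore_penrose_inverse_def hermitian_def
          conjugate_transpose_mult[of "M ** X" "M ** Y"])
    also have "(M ** X) ** (M ** Y) = M ** Y"
      using X by (simp add: is_moore_penrose_inverse_def matrix_mul_assoc)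
    finally show ?thesis
      using Y by (simp add: is_moore_penrose_inverse_def hermitian_def)
  qed
  have XM: "X ** M = Y ** M"
  proof -
    have "X ** M = (X ** M) ** (Y ** M)"
      using Y by (metis is_moore_penrose_inverse_def matrix_mul_assoc)
    also have "\<dots> = conjugate_transpose ((Y ** M) ** (X ** M))"
      using X Y by (simp add: is_moore_penrose_inverse_def hermitian_def
          conjugate_transpose_mult[of "Y ** M" "X ** M"])
    also have "(Y ** M) ** (X ** M) = Y ** M"
      using X by (metis is_moore_penrose_inverse_def matrix_mul_assoc)
    finally show ?thesis
      using Y by (simp add: is_moore_penrose_inverse_def hermitian_def)
  qed
  have "X = X ** M ** X" using X by (simp add: is_moore_penrose_inverse_def)
  also have "\<dots> = Y ** (M ** X)" by (simp add: XM matrix_mul_assoc)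
  also have "\<dots> = Y" using Y by (simp add: MX is_moore_penrose_inverse_def matrix_mul_assoc)
  finally show ?thesis .
qed

text \<open>A Hermitian matrix has the same kernel as its square, hence the same range.\<close>

lemma hermitian_factor_square:
  fixes T :: "complex ^ 'n ^ 'n"
  assumes h: "hermitian T"
  obtains X where "T ** T ** X = T"
proof -
  have "\<exists>z. T *v (T *v z) = T *v x" for x
  proof -
    let ?S = "range (\<lambda>z. T *v (T *v z))"
    have "subspace ?S"
      by (auto simp: subspace_def simp flip: matrix_vector_right_distrib matrix_vector_mult_scaleR_gen
          intro: image_eqI[of _ _ 0])
    then have span: "span ?S = ?S" by (simp add: span_eq_iff)
    \<comment> \<open>Project Tx onto the range of T^2. The residual v is orthogonal to T^2 v, so
      |Tv|^2 = 0; hence v is orthogonal to Tx as well as to u, and so to itself.\<close>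
    obtain u v where u: "u \<in> ?S" and v: "\<And>w. w \<in> ?S \<Longrightarrow> orthogonal v w"
      and eq: "T *v x = u + v"
      using orthogonal_subspace_decomp_exists[of ?S "T *v x"] span by metis
    have "v \<bullet> (T *v (T *v v)) = 0" using v by (auto simp: orthogonal_def)
    then have "(T *v v) \<bullet> (T *v v) = 0" by (simp add: hermitian_inner[OF h])
    then have "T *v v = 0" by simp
    then have "v \<bullet> (T *v x) = 0" using hermitian_inner[OF h, of v x] by simp
    moreover have "v \<bullet> u = 0" using v[OF u] by (simp add: orthogonal_def)
    ultimately have "v \<bullet> v = 0" by (simp add: eq inner_add_right)
    then show ?thesis using u eq by auto
  qed
  then obtain f where f: "\<And>x. T *v (T *v f x) = T *v x" by metis
  \<comment> \<open>The choice \<open>f\<close> need not be linear, so only its values at the basis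
    vectors are kept, as columns of X.\<close>
  define X where "X = (\<chi> i j. f (axis j 1) $ i)"
  have X: "column j X = f (axis j 1)" for j by (simp add: X_def column_def vec_eq_iff)
  have "column j (T ** T ** X) = column j T" for j
  proof -
    have "column j (T ** T ** X) = (T ** T) *v column j X"
      by (simp add: column_def matrix_matrix_mult_def matrix_vector_mult_def vec_eq_iff)
    also have "\<dots> = T *v axis j 1" by (simp add: X f flip: matrix_vector_mul_assoc)
    finally show ?thesis
      by (simp add: column_def matrix_vector_mult_def axis_def vec_eq_iff if_distrib cong: if_cong)
  qed
  then have "T ** T ** X = T" by (simp add: column_def vec_eq_iff)
  then show ?thesis using that by blast
qed

text \<open>If TTX = T, then TX = X* TTX = X* T, so P = TX is Hermitian; it is the orthogonal
  projection onto the range of T. The inverse is G = PX, for which TG = GT = P.\<close>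

lemma moore_penrose_inverse_exists:
  assumes h: "hermitian T"
  obtains G where "is_moore_penrose_inverse T G"
proof -
  obtain X where X: "T ** T ** X = T" by (rule hermitian_factor_square[OF h])
  define Y where "Y = conjugate_transpose X"
  have Y: "Y ** T ** T = T"
    using arg_cong[OF X, of conjugate_transpose] h
    by (simp add: Y_def conjugate_transpose_mult hermitian_def matrix_mul_assoc)
  define P where "P = T ** X"
  have P: "P = Y ** T"
    by (metis P_def X Y matrix_mul_assoc)
  have hP: "hermitian P"
    using h by (metis P P_def Y_def conjugate_transpose_mult hermitian_def)
  have PT: "P ** T = T" using P Y by simp
  have TP: "T ** P = T" using P_def X by (simp add: matrix_mul_assoc)
  have PP: "P ** P = P" using PT by (metis P_def matrix_mul_assoc)
  have TG: "T ** (P ** X) = P" using TP by (metis P_def matrix_mul_assoc)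
  have "P ** X ** T = Y ** T ** X ** T" by (simp add: P)
  also have "\<dots> = Y ** P ** T" by (simp add: P_def matrix_mul_assoc)
  also have "\<dots> = P" using PT by (metis P matrix_mul_assoc)
  finally have GT: "P ** X ** T = P" .
  have "is_moore_penrose_inverse T (P ** X)"
    unfolding is_moore_penrose_inverse_def
  proof (intro conjI)
    show "P ** X ** T ** (P ** X) = P ** X" by (simp add: GT PP matrix_mul_assoc)
  qed (simp_all only: TG GT PT hP)
  then show ?thesis using that by blast
qed

lemma is_moore_penrose_inverse_moore_penrose_inverse:
  assumes "hermitian T"
  shows "is_moore_penrose_inverse T (moore_penrose_inverse T)"
  unfolding moore_penrose_inverse_def
  using moore_penrose_inverse_exists[OF assms] moore_penrose_inverse_unique by (metis theI)

text \<open>Taking adjoints in the four defining equations shows that G* is an inverse of T* = T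
  too, so uniqueness applies.\<close>

lemma hermitian_moore_penrose_inverse:
  assumes "hermitian T"
  shows "hermitian (moore_penrose_inverse T)"
proof -
  let ?G = "moore_penrose_inverse T"
  have "is_moore_penrose_inverse T (conjugate_transpose ?G)"
    using is_moore_penrose_inverse_moore_penrose_inverse[OF assms] assms
    unfolding is_moore_penrose_inverse_def hermitian_def
    by (metis conjugate_transpose_mult matrix_mul_assoc)
  then show ?thesis
    unfolding hermitian_def
    using moore_penrose_inverse_unique is_moore_penrose_inverse_moore_penrose_inverse[OF assms]
    by blast
qed

text \<open>Since TGT = T, the vector x - GTx lies in the kernel of T, hence in that of W. The
  second equation is the adjoint of the first.\<close>

lemma moore_penrose_inverse_absorb:
  assumes "hermitian T" "hermitian W" and k: "\<And>x. T *v x = 0 \<Longrightarrow> W *v x = 0"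
  shows "W ** moore_penrose_inverse T ** T = W" "T ** moore_penrose_inverse T ** W = W"
proof -
  let ?G = "moore_penrose_inverse T"
  have G: "T ** ?G ** T = T"
    using is_moore_penrose_inverse_moore_penrose_inverse[OF assms(1)]
    by (simp add: is_moore_penrose_inverse_def)
  show 1: "W ** ?G ** T = W"
    unfolding matrix_eq
  proof
    fix x
    have "T *v (x - ?G *v (T *v x)) = 0"
      using G by (simp add: matrix_vector_mult_diff_distrib matrix_vector_mul_assoc matrix_mul_assoc)
    then have "W *v (x - ?G *v (T *v x)) = 0" by (rule k)
    then show "(W ** ?G ** T) *v x = W *v x"
      by (simp add: matrix_vector_mult_diff_distrib matrix_vector_mul_assoc matrix_mul_assoc)
  qed
  show "T ** ?G ** W = W"
    using arg_cong[OF 1, of conjugate_transpose] assms(1,2) hermitian_moore_penrose_inverse[OF assms(1)]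
    by (simp add: conjugate_transpose_mult hermitian_def matrix_mul_assoc)
qed

section \<open>Parallel sums and their quadratic forms\<close>

text \<open>Two nonnegative forms with sum zero both vanish. This supplies the kernel hypothesis of
  \<open>moore_penrose_inverse_absorb\<close> for a summand of P + Q.\<close>

lemma kernel_add_le:
  assumes "hermitian P" "\<And>x. 0 \<le> x \<bullet> (P *v x)" "\<And>x. 0 \<le> x \<bullet> (Q *v x)" "(P + Q) *v x = 0"
  shows "P *v x = 0"
proof -
  have "x \<bullet> (P *v x) + x \<bullet> (Q *v x) = 0"
    using assms(4) by (metis inner_add_right inner_zero_right matrix_vector_mult_add_rdistrib)
  then have "x \<bullet> (P *v x) = 0" using assms(2,3)[of x] by linarith
  then show ?thesis using inner_kernel assms(1,2) by blast
qed

lemma parallel_sum_eq: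
  fixes \<alpha> \<beta> :: real
  assumes P: "hermitian P" "positive_semidefinite P" and Q: "hermitian Q" "positive_semidefinite Q"
  defines "W \<equiv> \<beta> *\<^sub>R P - \<alpha> *\<^sub>R Q"
  shows "(\<alpha> + \<beta>)\<^sup>2 *\<^sub>R parallel_sum P Q
    = \<beta>\<^sup>2 *\<^sub>R P + \<alpha>\<^sup>2 *\<^sub>R Q - W ** moore_penrose_inverse (P + Q) ** W"
  unfolding matrix_eq
proof
  fix x
  let ?G = "moore_penrose_inverse (P + Q)"
  note p = positive_semidefinite_inner[OF P(2)] positive_semidefinite_inner[OF Q(2)]
  have h: "hermitian (P + Q)" using P Q by (simp add: hermitian_add)
  have kP: "P *v x = 0" and kQ: "Q *v x = 0" if "(P + Q) *v x = 0" for x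
    using kernel_add_le[OF P(1) p that] kernel_add_le[OF Q(1) p(2,1), of x] that
    by (auto simp: add.commute)
  note absorb = moore_penrose_inverse_absorb[OF h P(1) kP] moore_penrose_inverse_absorb[OF h Q(1) kQ]
  \<comment> \<open>Writing N for P : Q, absorption turns the four products into PGP = P - N, PGQ =
    QGP = N and QGQ = Q - N. Expanding WGW then collects N with coefficient -(\<alpha> +
    \<beta>)^2.\<close>
  define a b c d where "a = P *v (?G *v (P *v x))" and "b = P *v (?G *v (Q *v x))"
    and "c = Q *v (?G *v (P *v x))" and "d = Q *v (?G *v (Q *v x))"
  have "a + b = P *v x" "a + c = P *v x" "b + d = Q *v x"
    using absorb(1,2,4)[THEN arg_cong, of "\<lambda>M. M *v x"]
    by (simp_all add: a_def b_def c_def d_def matrix_vector_mult_add_rdistrib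
        matrix_vector_right_distrib flip: matrix_vector_mul_assoc)
  then have *: "a = P *v x - b" "c = b" "d = Q *v x - b"
    by (metis add_diff_cancel_right' add_left_cancel add_diff_cancel_left')+
  have "(W ** ?G ** W) *v x = \<beta>\<^sup>2 *\<^sub>R a - (\<alpha> * \<beta>) *\<^sub>R b - (\<alpha> * \<beta>) *\<^sub>R c + \<alpha>\<^sup>2 *\<^sub>R d"
    by (simp add: W_def a_def b_def c_def d_def matrix_vector_mult_diff_rdistrib
        matrix_vector_mult_diff_distrib scaleR_matrix_vector_mult matrix_vector_mult_scaleR_gen
        power2_eq_square algebra_simps flip: matrix_vector_mul_assoc)
  moreover have "parallel_sum P Q *v x = b"
    by (simp add: parallel_sum_def b_def flip: matrix_vector_mul_assoc)
  ultimately show "((\<alpha> + \<beta>)\<^sup>2 *\<^sub>R parallel_sum P Q) *v x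
      = (\<beta>\<^sup>2 *\<^sub>R P + \<alpha>\<^sup>2 *\<^sub>R Q - W ** ?G ** W) *v x"
    by (simp add: * matrix_vector_mult_diff_rdistrib matrix_vector_mult_add_rdistrib
        scaleR_matrix_vector_mult)
      (simp add: vec_eq_iff scaleR_conv_of_real power2_eq_square algebra_simps)
qed

text \<open>The form of S : R at x is the minimum over z of <S(x - z), x - z> + <Rz, z>; trial
  vectors z = tx bound it from above.\<close>

lemma spectral_norm_parallel_le:
  assumes S: "hermitian S" "positive_semidefinite S" and R: "hermitian R" "positive_semidefinite R"
  shows "spectral_norm (S - S ** moore_penrose_inverse (S + R) ** S)
    \<le> spectral_norm S * spectral_norm R / (spectral_norm S + spectral_norm R)"
proof (rule spectral_norm_le_of_form)
  let ?G = "moore_penrose_inverse (S + R)"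
  let ?s = "spectral_norm S" and ?r = "spectral_norm R"
  note pS = positive_semidefinite_inner[OF S(2)] and pR = positive_semidefinite_inner[OF R(2)]
  have h: "hermitian (S + R)" using S R by (simp add: hermitian_add)
  have hG: "hermitian ?G" by (rule hermitian_moore_penrose_inverse[OF h])
  have absorb: "S ** ?G ** (S + R) = S" "(S + R) ** ?G ** S = S"
    using moore_penrose_inverse_absorb[OF h S(1)] kernel_add_le[OF S(1) pS pR] by blast+
  show "hermitian (S - S ** ?G ** S)"
    using S(1) hG by (simp add: hermitian_def conjugate_transpose_diff conjugate_transpose_mult
        matrix_mul_assoc)
  show "0 \<le> ?s * ?r / (?s + ?r)"
    by (simp add: spectral_norm_nonneg)
  fix x
  \<comment> \<open>A minimiser of that functional: its stationarity condition is (S + R)y =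
    Sx.\<close>
  define y where "y = ?G *v (S *v x)"
  have Ty: "(S + R) *v y = S *v x"
    using absorb(2)[THEN arg_cong, of "\<lambda>M. M *v x"] by (simp add: y_def flip: matrix_vector_mul_assoc)
  then have RSy: "R *v y = S *v x - S *v y"
    by (simp add: matrix_vector_mult_add_rdistrib algebra_simps)
  have M: "x \<bullet> ((S - S ** ?G ** S) *v x) = x \<bullet> (S *v x) - x \<bullet> (S *v y)"
    by (simp add: y_def matrix_vector_mult_diff_rdistrib inner_diff_right flip: matrix_vector_mul_assoc)
  have sy: "y \<bullet> (S *v x) = x \<bullet> (S *v y)"
    using hermitian_inner[OF S(1), of y x] by (simp add: inner_commute)
  have ry: "y \<bullet> (R *v x) = x \<bullet> (R *v y)"
    using hermitian_inner[OF R(1), of y x] by (simp add: inner_commute)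
  \<comment> \<open>The functional at y equals the form of S - SGS at x, which makes that form
    nonnegative.\<close>
  have "0 \<le> (x - y) \<bullet> (S *v (x - y)) + y \<bullet> (R *v y)"
    using pS pR by (intro add_nonneg_nonneg) auto
  also have "\<dots> = x \<bullet> (S *v x) - x \<bullet> (S *v y)"
    using sy by (simp add: RSy matrix_vector_mult_diff_distrib inner_diff_left inner_diff_right)
  finally show "0 \<le> x \<bullet> ((S - S ** ?G ** S) *v x)" by (simp add: M)
  have form: "x \<bullet> ((S - S ** ?G ** S) *v x) \<le> (1 - t)\<^sup>2 * (x \<bullet> (S *v x)) + t\<^sup>2 * (x \<bullet> (R *v x))" for t
  proof -
    \<comment> \<open>The functional at tx exceeds its value at y by exactly the form of S + R at tx
      - y.\<close>
    let ?z = "t *\<^sub>R x - y"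
    have "0 \<le> ?z \<bullet> (S *v ?z) + ?z \<bullet> (R *v ?z)"
      using pS pR by (intro add_nonneg_nonneg) auto
    then show ?thesis
      unfolding M using sy ry
      by (simp add: RSy matrix_vector_mult_diff_distrib matrix_vector_mult_scaleR_gen
          inner_diff_left inner_diff_right power2_eq_square algebra_simps)
  qed
  show "x \<bullet> ((S - S ** ?G ** S) *v x) \<le> ?s * ?r / (?s + ?r) * (norm x)\<^sup>2"
  proof -
    \<comment> \<open>This t minimises (1 - t)^2 s + t^2 r when s + r is positive.\<close>
    define t where "t = ?s / (?s + ?r)"
    have "(1 - t)\<^sup>2 * (x \<bullet> (S *v x)) + t\<^sup>2 * (x \<bullet> (R *v x))
        \<le> (1 - t)\<^sup>2 * (?s * (norm x)\<^sup>2) + t\<^sup>2 * (?r * (norm x)\<^sup>2)"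
      by (intro add_mono mult_left_mono inner_le_spectral_norm) simp_all
    also have "\<dots> = ((1 - t)\<^sup>2 * ?s + t\<^sup>2 * ?r) * (norm x)\<^sup>2" by (simp add: algebra_simps)
    also have "(1 - t)\<^sup>2 * ?s + t\<^sup>2 * ?r = ?s * ?r / (?s + ?r)"
    \<comment> \<open>If s + r = 0, both norms vanish and, division by zero being 0, both sides are
      0.\<close>
    proof (cases "?s + ?r = 0")
      case True
      then have "?s = 0" "?r = 0" using spectral_norm_nonneg[of S] spectral_norm_nonneg[of R] by linarith+
      then show ?thesis by simp
    next
      case False
      then have "1 - t = ?r / (?s + ?r)" by (simp add: t_def field_simps)
      then have "(1 - t)\<^sup>2 * ?s + t\<^sup>2 * ?r = ?s * ?r * (?s + ?r) / (?s + ?r)\<^sup>2"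
        by (simp only: t_def power_divide times_divide_eq_left add_divide_distrib[symmetric])
          (simp add: power2_eq_square algebra_simps)
      then show ?thesis using False by (simp add: power2_eq_square)
    qed
    finally show ?thesis using form[of t] by linarith
  qed
qed

section \<open>Parallel sums under a shift by multiples of Z\<close>

text \<open>The change of the inverse is written as a product with X* on the left and X on the
  right, so that its norm is at most |X|^2 times a quantity depending only on S and cZ.\<close>

lemma parallel_sum_shift:
  fixes \<alpha> \<beta> :: real
  assumes A: "hermitian A" "positive_semidefinite A" and B: "hermitian B" "positive_semidefinite B"
    and Z: "hermitian Z" "positive_semidefinite Z" and pos: "0 < \<alpha>" "0 < \<beta>"
  defines "S \<equiv> A + B" and "c \<equiv> \<alpha> + \<beta>"
  defines "X \<equiv> moore_penrose_inverse S ** (\<beta> *\<^sub>R A - \<alpha> *\<^sub>R B)"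
  shows "c\<^sup>2 *\<^sub>R (parallel_sum (A + \<alpha> *\<^sub>R Z) (B + \<beta> *\<^sub>R Z) - parallel_sum A B)
    = (\<alpha> * \<beta> * c) *\<^sub>R Z
      + conjugate_transpose X ** (S - S ** moore_penrose_inverse (S + c *\<^sub>R Z) ** S) ** X"
proof -
  define W where "W = \<beta> *\<^sub>R A - \<alpha> *\<^sub>R B"
  let ?G = "moore_penrose_inverse S" and ?H = "moore_penrose_inverse (S + c *\<^sub>R Z)"
  have shift: "hermitian (P + r *\<^sub>R Z)" "positive_semidefinite (P + r *\<^sub>R Z)"
    if "hermitian P" "positive_semidefinite P" "0 < r" for P and r :: real
    using that Z by (auto intro: hermitian_add hermitian_scaleR positive_semidefinite_add_scaleR)
  have hW: "hermitian W" using A B by (simp add: W_def hermitian_diff hermitian_scaleR)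
  have hS: "hermitian S" using A B by (simp add: S_def hermitian_add)
  have W': "\<beta> *\<^sub>R (A + \<alpha> *\<^sub>R Z) - \<alpha> *\<^sub>R (B + \<beta> *\<^sub>R Z) = W"
    by (simp add: W_def algebra_simps)
  have S': "A + \<alpha> *\<^sub>R Z + (B + \<beta> *\<^sub>R Z) = S + c *\<^sub>R Z"
    by (simp add: S_def c_def algebra_simps)
  note pA = positive_semidefinite_inner[OF A(2)] and pB = positive_semidefinite_inner[OF B(2)]
  have kW: "W *v x = 0" if "S *v x = 0" for x
  proof -
    have "A *v x = 0" "B *v x = 0"
      using kernel_add_le[OF A(1) pA pB, of x] kernel_add_le[OF B(1) pB pA, of x] that
      by (auto simp: S_def add.commute)
    then show ?thesis
      by (simp add: W_def matrix_vector_mult_diff_rdistrib scaleR_matrix_vector_mult)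
  qed
  have W: "W ** ?G ** S = W" "S ** ?G ** W = W"
    using moore_penrose_inverse_absorb[OF hS hW kW] by blast+
  have X: "conjugate_transpose X = W ** ?G" "X = ?G ** W"
    using hW hermitian_moore_penrose_inverse[OF hS]
    by (simp_all add: X_def W_def[symmetric] conjugate_transpose_mult hermitian_def)
  have "c\<^sup>2 *\<^sub>R parallel_sum A B = \<beta>\<^sup>2 *\<^sub>R A + \<alpha>\<^sup>2 *\<^sub>R B - W ** ?G ** W"
    using parallel_sum_eq[OF A B, of \<alpha> \<beta>] by (simp add: c_def W_def S_def)
  moreover have "c\<^sup>2 *\<^sub>R parallel_sum (A + \<alpha> *\<^sub>R Z) (B + \<beta> *\<^sub>R Z)
      = \<beta>\<^sup>2 *\<^sub>R (A + \<alpha> *\<^sub>R Z) + \<alpha>\<^sup>2 *\<^sub>R (B + \<beta> *\<^sub>R Z) - W ** ?H ** W"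
    using parallel_sum_eq[OF shift[OF A pos(1)] shift[OF B pos(2)], of \<alpha> \<beta>] unfolding W' S'
    by (simp add: c_def)
  \<comment> \<open>The multiples of Z combine as \<beta>^2 \<alpha> + \<alpha>^2 \<beta> =
    \<alpha>\<beta>c.\<close>
  ultimately have "c\<^sup>2 *\<^sub>R (parallel_sum (A + \<alpha> *\<^sub>R Z) (B + \<beta> *\<^sub>R Z) - parallel_sum A B)
      = (\<alpha> * \<beta> * c) *\<^sub>R Z + (W ** ?G ** W - W ** ?H ** W)"
    by (simp add: c_def power2_eq_square algebra_simps)
  \<comment> \<open>Absorption gives X* S = W and SX = W, so X* S X = WGW and X* SHS X =
    WHW.\<close>
  also have "W ** ?G ** W - W ** ?H ** W = conjugate_transpose X ** (S - S ** ?H ** S) ** X"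
  proof -
    have "conjugate_transpose X ** (S - S ** ?H ** S) ** X
        = W ** ?G ** S ** (?G ** W) - W ** ?G ** S ** ?H ** (S ** ?G ** W)"
      unfolding X(1) unfolding X(2) by (simp add: matrix_eq matrix_vector_mult_diff_rdistrib
          matrix_vector_mult_diff_distrib flip: matrix_vector_mul_assoc)
    then show ?thesis by (simp add: W matrix_mul_assoc)
  qed
  finally show ?thesis .
qed

theorem theorem3p4:
  fixes A B Z :: "complex ^ 'n ^ 'n" and \<alpha> \<beta> :: real
  assumes "hermitian A" and "positive_semidefinite A"
    and "hermitian B" and "positive_semidefinite B"
    and "hermitian Z" and "positive_semidefinite Z"
    and "\<alpha> > 0" and "\<beta> > 0"
  shows "spectral_norm (parallel_sum (A + \<alpha> *\<^sub>R Z) (B + \<beta> *\<^sub>R Z) - parallel_sum A B)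
           \<le> 1 / (\<alpha> + \<beta>) *
              ((spectral_norm (moore_penrose_inverse (A + B) ** (\<beta> *\<^sub>R A - \<alpha> *\<^sub>R B)))\<^sup>2
                  * spectral_norm (A + B)
                  / (spectral_norm (A + B) + (\<alpha> + \<beta>) * spectral_norm Z)
                + \<alpha> * \<beta>) * spectral_norm Z
       \<and> 1 / (\<alpha> + \<beta>) *
              ((spectral_norm (moore_penrose_inverse (A + B) ** (\<beta> *\<^sub>R A - \<alpha> *\<^sub>R B)))\<^sup>2
                  * spectral_norm (A + B)
                  / (spectral_norm (A + B) + (\<alpha> + \<beta>) * spectral_norm Z)
                + \<alpha> * \<beta>) * spectral_norm Z
           \<le> 1 / (\<alpha> + \<beta>) *
              ((spectral_norm (moore_penrose_inverse (A + B) ** (\<beta> *\<^sub>R A - \<alpha> *\<^sub>R B)))\<^sup>2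
                + \<alpha> * \<beta>) * spectral_norm Z"
proof -
  define c where "c = \<alpha> + \<beta>"
  define S where "S = A + B"
  define X where "X = moore_penrose_inverse S ** (\<beta> *\<^sub>R A - \<alpha> *\<^sub>R B)"
  define F where "F = parallel_sum (A + \<alpha> *\<^sub>R Z) (B + \<beta> *\<^sub>R Z) - parallel_sum A B"
  define M where "M = S - S ** moore_penrose_inverse (S + c *\<^sub>R Z) ** S"
  let ?s = "spectral_norm S" and ?x = "spectral_norm X" and ?z = "spectral_norm Z"
  have c: "0 < c" using assms by (simp add: c_def)
  have nonneg: "0 \<le> ?s" "0 \<le> ?x" "0 \<le> ?z" by (simp_all add: spectral_norm_nonneg)
  have S: "hermitian S" "positive_semidefinite S"
    using assms hermitian_add positive_semidefinite_add_scaleR[of A B 1] by (auto simp: S_def)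
  have cZ: "hermitian (c *\<^sub>R Z)" "positive_semidefinite (c *\<^sub>R Z)"
    using assms c hermitian_scaleR positive_semidefinite_add_scaleR[of 0 Z c]
    by (auto simp: positive_semidefinite_def)
  have M: "spectral_norm M \<le> ?s * (c * ?z) / (?s + c * ?z)"
    using spectral_norm_parallel_le[OF S cZ] c by (simp add: M_def spectral_norm_scaleR)
  have "c\<^sup>2 *\<^sub>R F = (\<alpha> * \<beta> * c) *\<^sub>R Z + conjugate_transpose X ** M ** X"
    using parallel_sum_shift[OF assms] by (simp add: F_def S_def c_def X_def M_def)
  then have "c\<^sup>2 * spectral_norm F
      \<le> spectral_norm ((\<alpha> * \<beta> * c) *\<^sub>R Z) + spectral_norm (conjugate_transpose X ** M ** X)"
    using spectral_norm_add_le spectral_norm_scaleR[of "c\<^sup>2" F] by (metis abs_power2)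
  also have "spectral_norm ((\<alpha> * \<beta> * c) *\<^sub>R Z) = \<alpha> * \<beta> * c * ?z"
    using assms c by (simp add: spectral_norm_scaleR abs_mult)
  also have "spectral_norm (conjugate_transpose X ** M ** X) \<le> ?x * spectral_norm M * ?x"
    by (intro order_trans[OF spectral_norm_mult_le] mult_right_mono
        mult_mono spectral_norm_conjugate_transpose_le spectral_norm_nonneg order_refl)
  also have "\<dots> \<le> ?x * (?s * (c * ?z) / (?s + c * ?z)) * ?x"
    using M nonneg by (intro mult_right_mono mult_left_mono)
  \<comment> \<open>Both summands of the bound contain a factor c, the second because R = cZ has
    norm c|Z|. It cancels one factor of c^2, and the other becomes the prefactor 1 / c.\<close>
  finally have "c * (c * spectral_norm F) \<le> c * ((?x\<^sup>2 * ?s / (?s + c * ?z) + \<alpha> * \<beta>) * ?z)"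
    by (simp add: power2_eq_square algebra_simps)
  then have "c * spectral_norm F \<le> (?x\<^sup>2 * ?s / (?s + c * ?z) + \<alpha> * \<beta>) * ?z"
    using c by (simp add: mult_le_cancel_left)
  then have 1: "spectral_norm F \<le> 1 / c * (?x\<^sup>2 * ?s / (?s + c * ?z) + \<alpha> * \<beta>) * ?z"
    using c by (simp add: field_simps)
  \<comment> \<open>The weaker bound only drops this quotient. A vanishing denominator is covered,
    the quotient then being 0.\<close>
  have "?s / (?s + c * ?z) \<le> 1"
    using nonneg(1) mult_nonneg_nonneg[of c ?z] nonneg(3) c unfolding divide_le_eq_1 by linarith
  then have "?x\<^sup>2 * ?s / (?s + c * ?z) \<le> ?x\<^sup>2"
    using mult_left_mono[of "?s / (?s + c * ?z)" 1 "?x\<^sup>2"] by simp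
  then have "1 / c * (?x\<^sup>2 * ?s / (?s + c * ?z) + \<alpha> * \<beta>) * ?z \<le> 1 / c * (?x\<^sup>2 + \<alpha> * \<beta>) * ?z"
    using c nonneg by (intro mult_right_mono mult_left_mono add_right_mono) auto
  with 1 show ?thesis by (simp add: F_def S_def X_def c_def)
qed

end
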